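(* Let $(u_n)_{n\ge0}$ be a sequence of fuzzy numbers, let $\mu$ be a fuzzy number, and let $p>0$ be a real number. If $(u_n)$ is $E_p$ summable to $\mu$, then $(u_n)$ is Borel summable to $\mu$.
   Context: A fuzzy number is a function $u:\mathbb{R}\to[0,1]$ that is normal ($u(t_0)=1$ for some $t_0$), fuzzy convex ($u(\lambda s+(1-\lambda)t)\ge\min\{u(s),u(t)\}$ for $s,t\in\mathbb{R}$, $\lambda\in[0,1]$), upper semicontinuous, and has compact support $\overline{\{t:u(t)>0\}}$. The set of fuzzy numbers is $E^1$. For $u\in E^1$ the $\alpha$-level set is $[u]_\alpha=\{t:u(t)\ge\alpha\}$ for $0<\alpha\le1$ and $[u]_0=\overline{\{t:u(t)>0\}}$; it is a compact interval, written $[u]_\alpha=[u^-_\alpha,u^+_\alpha]$. Addition and scalar multiplication ($k\in\mathbb{R}$) are defined by $[u+v]_\alpha=[u^-_\alpha+v^-_\alpha,\,u^+_\alpha+v^+_\alpha]$ and $[ku]_\alpha=k[u]_\alpha$ for all $\alpha\in[0,1]$. The metric on $E^1$ is $D(u,v)=\sup_{\alpha\in[0,1]}\max\{|u^-_\alpha-v^-_\alpha|,|u^+_\alpha-v^+_\alpha|\}$; convergence and limits in $E^1$ are with respect to $D$. A series $\sum_{n=0}^\infty u_n$ of fuzzy numbers converges to $u\in E^1$ if its partial sums $\sum_{k=0}^n u_k$ converge to $u$. For real $p>0$, the Euler means of a sequence $(u_n)_{n\ge0}$ of fuzzy numbers are $t^p_n=\frac{1}{(p+1)^n}\sum_{k=0}^n\binom{n}{k}p^{n-k}u_k$,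 and $(u_n)$ is $E_p$ summable to $\mu\in E^1$ if $\lim_{n\to\infty}t^p_n=\mu$. The sequence $(u_n)$ is Borel summable to $\mu$ if the series $\sum_{n=0}^\infty\frac{x^n}{n!}u_n$ converges for all $x\in(0,\infty)$ and $\lim_{x\to\infty}e^{-x}\sum_{n=0}^\infty\frac{x^n}{n!}u_n=\mu$. *)

theory Defs
  imports "HOL-Analysis.Analysis"
begin

definition fuzzy_convex :: "(real \<Rightarrow> real) \<Rightarrow> bool" where
  "fuzzy_convex u \<longleftrightarrow>
     (\<forall>s t. \<forall>l\<in>{0..1}. u (l * s + (1 - l) * t) \<ge> min (u s) (u t))"

definition upper_semicontinuous :: "(real \<Rightarrow> real) \<Rightarrow> bool" where
  "upper_semicontinuous u \<longleftrightarrow> (\<forall>t y. u t < y \<longrightarrow> (\<forall>\<^sub>F s in nhds t. u s < y))"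

definition is_fuzzy_number :: "(real \<Rightarrow> real) \<Rightarrow> bool" where
  "is_fuzzy_number u \<longleftrightarrow>
     (\<forall>t. u t \<in> {0..1}) \<and> (\<exists>t. u t = 1) \<and> fuzzy_convex u \<and>
     upper_semicontinuous u \<and> compact (closure {t. u t > 0})"

lemma is_fuzzy_number_crisp: "is_fuzzy_number (\<lambda>t. if t = c then 1 else 0)"
proof -
  let ?u = "\<lambda>t::real. if t = c then 1 else (0::real)"
  have "upper_semicontinuous ?u"
    unfolding upper_semicontinuous_def
  proof (intro allI impI)
    fix t y assume ty: "?u t < y"
    show "\<forall>\<^sub>F s in nhds t. ?u s < y"
    proof (cases "t = c")
      case True
      then have "?u s < y" for s using ty by (simp split: if_splits)
      then show ?thesis by (intro always_eventually) blast
    next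
      case False
      then have "\<forall>\<^sub>F s in nhds t. s \<in> - {c}"
        by (intro eventually_nhds_in_open) auto
      then show ?thesis
        by eventually_elim (use ty False in simp)
    qed
  qed
  moreover have "{t. ?u t > 0} = {c}"
    by auto
  moreover have "fuzzy_convex ?u"
    unfolding fuzzy_convex_def
  proof (intro allI ballI)
    fix s t l :: real
    have "l * c + (1 - l) * c = c" by (simp add: algebra_simps)
    then show "min (?u s) (?u t) \<le> ?u (l * s + (1 - l) * t)"
      by (cases "s = c"; cases "t = c") simp_all
  qed
  moreover have "\<exists>t. ?u t = 1" by (intro exI[of _ c]) simp
  ultimately show ?thesis
    by (simp add: is_fuzzy_number_def)
qed

typedef fuzzy = "{u. is_fuzzy_number u}"
  morphisms membership Fuzzy
  using is_fuzzy_number_crisp by blast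

text \<open>Level sets and their end points are only meaningful for \<open>\<alpha> \<in> {0..1}\<close>.\<close>

definition level :: "fuzzy \<Rightarrow> real \<Rightarrow> real set" where
  "level u \<alpha> = (if \<alpha> = 0 then closure {t. membership u t > 0} else {t. membership u t \<ge> \<alpha>})"

definition lower :: "fuzzy \<Rightarrow> real \<Rightarrow> real" where
  "lower u \<alpha> = Inf (level u \<alpha>)"

definition upper :: "fuzzy \<Rightarrow> real \<Rightarrow> real" where
  "upper u \<alpha> = Sup (level u \<alpha>)"

lemma membership_fuzzy: "is_fuzzy_number (membership u)"
  using membership by auto

lemma membership_bounds: "0 \<le> membership u t" "membership u t \<le> 1"
  using membership_fuzzy[of u] by (auto simp: is_fuzzy_number_def)

lemma membership_interval:
  assumes "s \<le> x" "x \<le> t"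
  shows "min (membership u s) (membership u t) \<le> membership u x"
proof (cases "s = t")
  case True
  then show ?thesis using assms by simp
next
  case False
  define l where "l = (t - x) / (t - s)"
  have "s < t" using False assms by simp
  then have l: "l \<in> {0..1}"
    unfolding l_def atLeastAtMost_iff using assms
    by (intro conjI divide_nonneg_pos) (simp_all add: divide_le_eq_1)
  have "l * (t - s) = t - x"
    using \<open>s < t\<close> by (simp add: l_def)
  then have x: "l * s + (1 - l) * t = x"
    by (simp add: algebra_simps)
  have "fuzzy_convex (membership u)"
    using membership_fuzzy[of u] by (simp only: is_fuzzy_number_def)
  then have "min (membership u s) (membership u t) \<le> membership u (l * s + (1 - l) * t)"
    using l unfolding fuzzy_convex_def by blast
  then show ?thesis by (simp only: x)
qed

lemma level_antimono:
  assumes "0 \<le> \<alpha>" "\<alpha> \<le> \<beta>"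
  shows "level u \<beta> \<subseteq> level u \<alpha>"
proof (cases "\<alpha> = 0")
  case True
  show ?thesis
  proof (cases "\<beta> = 0")
    case False
    then have "{t. membership u t \<ge> \<beta>} \<subseteq> {t. membership u t > 0}"
      using assms by (intro Collect_mono impI) linarith
    also have "\<dots> \<subseteq> closure {t. membership u t > 0}" by (rule closure_subset)
    finally show ?thesis using True False by (simp add: level_def)
  qed (simp add: True)
next
  case False
  then have "{t. membership u t \<ge> \<beta>} \<subseteq> {t. membership u t \<ge> \<alpha>}"
    using assms by (intro Collect_mono impI) linarith
  then show ?thesis using assms False by (simp add: level_def)
qed

lemma closed_superlevel: "closed {t. membership u t \<ge> \<alpha>}"
proof -
  have "open {t. membership u t < \<alpha>}"
  proof (subst open_subopen, intro ballI)
    fix t assume "t \<in> {t. membership u t < \<alpha>}"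
    then have "\<forall>\<^sub>F s in nhds t. membership u s < \<alpha>"
      using membership_fuzzy[of u]
      unfolding is_fuzzy_number_def upper_semicontinuous_def by blast
    then show "\<exists>T. open T \<and> t \<in> T \<and> T \<subseteq> {t. membership u t < \<alpha>}"
      unfolding eventually_nhds by blast
  qed
  moreover have "- {t. membership u t \<ge> \<alpha>} = {t. membership u t < \<alpha>}" by auto
  ultimately show ?thesis by (simp add: closed_def)
qed

lemma level_eq_interval:
  assumes "\<alpha> \<in> {0..1}"
  shows "level u \<alpha> = {lower u \<alpha>..upper u \<alpha>}" and "lower u \<alpha> \<le> upper u \<alpha>"
proof -
  have "compact (level u 0)"
    using membership_fuzzy[of u] by (simp add: level_def is_fuzzy_number_def)
  moreover have "closed (level u \<alpha>)"
    using closed_superlevel by (auto simp: level_def)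
  moreover have "level u \<alpha> \<subseteq> level u 0"
    using assms by (intro level_antimono) auto
  ultimately have c: "compact (level u \<alpha>)"
    by (metis compact_Int_closed inf.absorb_iff2)
  obtain t where "membership u t = 1"
    using membership_fuzzy[of u] by (auto simp: is_fuzzy_number_def)
  then have "t \<in> level u 1" by (auto simp: level_def)
  then have ne: "level u \<alpha> \<noteq> {}"
    using level_antimono[of \<alpha> 1 u] assms by auto
  have convI: "convex A"
    if "\<And>s t x. s \<in> A \<Longrightarrow> t \<in> A \<Longrightarrow> s \<le> x \<Longrightarrow> x \<le> t \<Longrightarrow> x \<in> A" for A :: "real set"
    using that unfolding is_interval_convex_1[symmetric] is_interval_1 by blast
  have "convex (level u \<alpha>)"
  proof (cases "\<alpha> = 0")
    case True
    have "convex {t. membership u t > 0}"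
    proof (rule convI)
      fix s t x
      assume "s \<in> {t. membership u t > 0}" "t \<in> {t. membership u t > 0}" "s \<le> x" "x \<le> t"
      then show "x \<in> {t. membership u t > 0}"
        using membership_interval[of s x t u] unfolding mem_Collect_eq by linarith
    qed
    then have "convex (closure {t. membership u t > 0})" by (rule convex_closure)
    then show ?thesis by (simp add: True level_def)
  next
    case False
    have "convex {t. membership u t \<ge> \<alpha>}"
    proof (rule convI)
      fix s t x
      assume "s \<in> {t. membership u t \<ge> \<alpha>}" "t \<in> {t. membership u t \<ge> \<alpha>}" "s \<le> x" "x \<le> t"
      then show "x \<in> {t. membership u t \<ge> \<alpha>}"
        using membership_interval[of s x t u] unfolding mem_Collect_eq by linarith
    qed
    then show ?thesis by (simp add: False level_def)
  qed
  then have "is_interval (level u \<alpha>)" by (simp only: is_interval_convex_1)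
  then have "connected (level u \<alpha>)" by (simp only: is_interval_connected_1)
  then obtain a b where ab: "level u \<alpha> = {a..b}"
    using c connected_compact_interval_1[of "level u \<alpha>"] by blast
  then have "a \<le> b" using ne by simp
  then have "lower u \<alpha> = a" "upper u \<alpha> = b"
    by (simp_all add: lower_def upper_def ab)
  then show "level u \<alpha> = {lower u \<alpha>..upper u \<alpha>}" "lower u \<alpha> \<le> upper u \<alpha>"
    using ab \<open>a \<le> b\<close> by simp_all
qed

lemma fuzzy_eqI:
  assumes "\<And>\<alpha>. \<alpha> \<in> {0..1} \<Longrightarrow> level u \<alpha> = level v \<alpha>"
  shows "u = v"
proof -
  have *: "\<alpha> \<le> membership u t \<longleftrightarrow> \<alpha> \<le> membership v t" if "0 < \<alpha>" "\<alpha> \<le> 1" for \<alpha> t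
  proof -
    have "t \<in> level u \<alpha> \<longleftrightarrow> t \<in> level v \<alpha>" using assms[of \<alpha>] that by simp
    then show ?thesis using that by (simp add: level_def)
  qed
  have "membership u t = membership v t" for t
    using *[of "membership u t" t] *[of "membership v t" t]
      membership_bounds[of u t] membership_bounds[of v t] by linarith
  then have "membership u = membership v" by blast
  then show ?thesis by (simp add: membership_inject)
qed

lemma fuzzy_eqI2:
  assumes "\<And>\<alpha>. \<alpha> \<in> {0..1} \<Longrightarrow> lower u \<alpha> = lower v \<alpha>" "\<And>\<alpha>. \<alpha> \<in> {0..1} \<Longrightarrow> upper u \<alpha> = upper v \<alpha>"
  shows "u = v"
proof (rule fuzzy_eqI)
  fix \<alpha> :: real assume "\<alpha> \<in> {0..1}"
  then show "level u \<alpha> = level v \<alpha>"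
    by (simp only: level_eq_interval(1) assms)
qed

lemma lower_upper_mono:
  assumes "0 \<le> \<alpha>" "\<alpha> \<le> \<beta>" "\<beta> \<le> 1"
  shows "lower u \<alpha> \<le> lower u \<beta>" "upper u \<beta> \<le> upper u \<alpha>"
proof -
  have "{lower u \<beta>..upper u \<beta>} \<subseteq> {lower u \<alpha>..upper u \<alpha>}"
    using level_antimono[OF assms(1,2), of u] level_eq_interval(1)[of \<alpha> u] level_eq_interval(1)[of \<beta> u]
      assms by simp
  then show "lower u \<alpha> \<le> lower u \<beta>" "upper u \<beta> \<le> upper u \<alpha>"
    using level_eq_interval(2)[of \<beta> u] assms by (simp_all only: atLeastatMost_subset_iff atLeastAtMost_iff) auto
qed

lemma lower_upper_left:
  assumes "0 < \<alpha>" "\<alpha> \<le> 1"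
  shows "x < lower u \<alpha> \<Longrightarrow> \<exists>\<beta>. 0 < \<beta> \<and> \<beta> < \<alpha> \<and> x < lower u \<beta>"
    and "upper u \<alpha> < x \<Longrightarrow> \<exists>\<beta>. 0 < \<beta> \<and> \<beta> < \<alpha> \<and> upper u \<beta> < x"
proof -
  have *: "\<exists>\<beta>. 0 < \<beta> \<and> \<beta> < \<alpha> \<and> x \<notin> {lower u \<beta>..upper u \<beta>}" if "x \<notin> level u \<alpha>"
  proof -
    have "membership u x < \<alpha>" using that assms by (auto simp: level_def)
    then obtain \<beta> where b: "membership u x < \<beta>" "\<beta> < \<alpha>" using dense by blast
    then have "0 < \<beta>" using membership_bounds[of u x] by auto
    moreover have "x \<notin> level u \<beta>" using b \<open>0 < \<beta>\<close> by (auto simp: level_def)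
    ultimately show ?thesis using level_eq_interval(1)[of \<beta> u] b assms
      by (intro exI[of _ \<beta>]) auto
  qed
  show "\<exists>\<beta>. 0 < \<beta> \<and> \<beta> < \<alpha> \<and> x < lower u \<beta>" if x: "x < lower u \<alpha>"
  proof -
    have "x \<notin> level u \<alpha>" using x level_eq_interval(1)[of \<alpha> u] assms by auto
    then obtain \<beta> where b: "0 < \<beta>" "\<beta> < \<alpha>" "x \<notin> {lower u \<beta>..upper u \<beta>}" using * by blast
    then show ?thesis
      using lower_upper_mono[of \<beta> \<alpha> u] level_eq_interval(2)[of \<alpha> u] x assms
      by (intro exI[of _ \<beta>]) auto
  qed
  show "\<exists>\<beta>. 0 < \<beta> \<and> \<beta> < \<alpha> \<and> upper u \<beta> < x" if x: "upper u \<alpha> < x"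
  proof -
    have "x \<notin> level u \<alpha>" using x level_eq_interval(1)[of \<alpha> u] assms by auto
    then obtain \<beta> where b: "0 < \<beta>" "\<beta> < \<alpha>" "x \<notin> {lower u \<beta>..upper u \<beta>}" using * by blast
    then show ?thesis
      using lower_upper_mono[of \<beta> \<alpha> u] level_eq_interval(2)[of \<alpha> u] x assms
      by (intro exI[of _ \<beta>]) auto
  qed
qed

lemma lower_upper_zero:
  shows "lower u 0 < x \<Longrightarrow> \<exists>\<beta>. 0 < \<beta> \<and> \<beta> \<le> 1 \<and> lower u \<beta> < x"
    and "x < upper u 0 \<Longrightarrow> \<exists>\<beta>. 0 < \<beta> \<and> \<beta> \<le> 1 \<and> x < upper u \<beta>"
proof -
  have *: "\<exists>t. 0 < membership u t \<and> dist t y < e" if "y \<in> level u 0" "e > 0" for y e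
    using that by (auto simp: level_def closure_approachable)
  have **: "t \<in> {lower u (membership u t)..upper u (membership u t)}" if "0 < membership u t" for t
    using level_eq_interval(1)[of "membership u t" u] membership_bounds[of u t] that
    by (auto simp: level_def)
  show "\<exists>\<beta>. 0 < \<beta> \<and> \<beta> \<le> 1 \<and> lower u \<beta> < x" if x: "lower u 0 < x"
  proof -
    obtain t where t: "0 < membership u t" "dist t (lower u 0) < x - lower u 0"
      using *[of "lower u 0" "x - lower u 0"] level_eq_interval[of 0 u] x by auto
    then show ?thesis using **[of t] membership_bounds[of u t]
      by (intro exI[of _ "membership u t"]) (auto simp: dist_real_def)
  qed
  show "\<exists>\<beta>. 0 < \<beta> \<and> \<beta> \<le> 1 \<and> x < upper u \<beta>" if x: "x < upper u 0"
  proof -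
    obtain t where t: "0 < membership u t" "dist t (upper u 0) < upper u 0 - x"
      using *[of "upper u 0" "upper u 0 - x"] level_eq_interval[of 0 u] x by auto
    then show ?thesis using **[of t] membership_bounds[of u t]
      by (intro exI[of _ "membership u t"]) (auto simp: dist_real_def)
  qed
qed

lemma stacking:
  fixes a b :: "real \<Rightarrow> real"
  assumes le: "\<And>\<alpha>. 0 \<le> \<alpha> \<Longrightarrow> \<alpha> \<le> 1 \<Longrightarrow> a \<alpha> \<le> b \<alpha>"
    and mono: "\<And>\<alpha> \<beta>. 0 \<le> \<alpha> \<Longrightarrow> \<alpha> \<le> \<beta> \<Longrightarrow> \<beta> \<le> 1 \<Longrightarrow> a \<alpha> \<le> a \<beta>"
      "\<And>\<alpha> \<beta>. 0 \<le> \<alpha> \<Longrightarrow> \<alpha> \<le> \<beta> \<Longrightarrow> \<beta> \<le> 1 \<Longrightarrow> b \<beta> \<le> b \<alpha>"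
    and left: "\<And>\<alpha> x. 0 < \<alpha> \<Longrightarrow> \<alpha> \<le> 1 \<Longrightarrow> x < a \<alpha> \<Longrightarrow> \<exists>\<beta>. 0 < \<beta> \<and> \<beta> < \<alpha> \<and> x < a \<beta>"
      "\<And>\<alpha> x. 0 < \<alpha> \<Longrightarrow> \<alpha> \<le> 1 \<Longrightarrow> b \<alpha> < x \<Longrightarrow> \<exists>\<beta>. 0 < \<beta> \<and> \<beta> < \<alpha> \<and> b \<beta> < x"
    and zero: "\<And>x. a 0 < x \<Longrightarrow> \<exists>\<beta>. 0 < \<beta> \<and> \<beta> \<le> 1 \<and> a \<beta> < x"
      "\<And>x. x < b 0 \<Longrightarrow> \<exists>\<beta>. 0 < \<beta> \<and> \<beta> \<le> 1 \<and> x < b \<beta>"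
  shows "\<exists>!w. \<forall>\<alpha>\<in>{0..1}. level w \<alpha> = {a \<alpha>..b \<alpha>}"
proof -
  define S where "S t = insert 0 {\<alpha>. 0 < \<alpha> \<and> \<alpha> \<le> 1 \<and> t \<in> {a \<alpha>..b \<alpha>}}" for t
  define w where "w t = Sup (S t)" for t
  have bdd: "bdd_above (S t)" for t
    by (rule bdd_aboveI[of _ 1]) (auto simp: S_def)
  have w01: "w t \<in> {0..1}" for t
  proof -
    have "0 \<le> w t" unfolding w_def by (intro cSup_upper bdd) (auto simp: S_def)
    moreover have "w t \<le> 1" unfolding w_def by (intro cSup_least) (auto simp: S_def)
    ultimately show ?thesis by simp
  qed
  have iff: "w t \<ge> \<alpha> \<longleftrightarrow> t \<in> {a \<alpha>..b \<alpha>}" if al: "0 < \<alpha>" "\<alpha> \<le> 1" for t \<alpha>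
  proof
    assume "t \<in> {a \<alpha>..b \<alpha>}"
    then show "w t \<ge> \<alpha>"
      unfolding w_def using al by (intro cSup_upper bdd) (auto simp: S_def)
  next
    assume w: "w t \<ge> \<alpha>"
    have *: "t \<in> {a \<beta>..b \<beta>}" if be: "0 < \<beta>" "\<beta> < \<alpha>" for \<beta>
    proof -
      have "\<beta> < Sup (S t)" using be w by (simp add: w_def)
      moreover have "S t \<noteq> {}" by (simp add: S_def)
      ultimately obtain \<gamma> where g: "\<gamma> \<in> S t" "\<beta> < \<gamma>"
        using less_cSup_iff[OF _ bdd] by blast
      then show ?thesis
        using be mono(1)[of \<beta> \<gamma>] mono(2)[of \<beta> \<gamma>] by (auto simp: S_def)
    qed
    have "\<not> t < a \<alpha>" using left(1)[OF al, of t] * by fastforce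
    moreover have "\<not> b \<alpha> < t" using left(2)[OF al, of t] * by fastforce
    ultimately show "t \<in> {a \<alpha>..b \<alpha>}" by auto
  qed
  have one: "w (a 1) = 1"
    using iff[of 1 "a 1"] le[of 1] w01[of "a 1"] by auto
  have conv: "fuzzy_convex w"
    unfolding fuzzy_convex_def
  proof (intro allI ballI)
    fix s t l :: real assume l: "l \<in> {0..1}"
    let ?m = "min (w s) (w t)"
    let ?x = "l * s + (1 - l) * t"
    show "w ?x \<ge> ?m"
    proof (cases "?m > 0")
      case True
      have m1: "?m \<le> 1" using w01[of s] by auto
      have "s \<in> {a ?m..b ?m}" "t \<in> {a ?m..b ?m}"
        using iff[OF True m1] min.cobounded1 min.cobounded2 by blast+
      then have "?x \<in> {a ?m..b ?m}"
        using convexD[OF convex_real_interval(5)[of "a ?m" "b ?m"], of s t l "1 - l"] l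
        by simp
      then show ?thesis using iff[OF True m1] by blast
    next
      case False
      then show ?thesis using w01[of ?x] by auto
    qed
  qed
  have usc: "upper_semicontinuous w"
    unfolding upper_semicontinuous_def
  proof (intro allI impI)
    fix t y assume ty: "w t < y"
    show "\<forall>\<^sub>F s in nhds t. w s < y"
    proof (cases "y \<le> 1")
      case True
      have y: "0 < y" using ty w01[of t] by auto
      have "t \<in> - {a y..b y}" using iff[OF y True, of t] ty by auto
      then have "\<forall>\<^sub>F s in nhds t. s \<in> - {a y..b y}"
        by (intro eventually_nhds_in_open) auto
      then show ?thesis
        by eventually_elim (use iff[OF y True] in \<open>meson ComplD not_le\<close>)
    next
      case False
      then have "w s < y" for s using w01[of s] by auto
      then show ?thesis by simp
    qed
  qed
  have clo: "closure {t. w t > 0} = {a 0..b 0}"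
  proof
    have "{t. w t > 0} \<subseteq> {a 0..b 0}"
    proof
      fix t assume "t \<in> {t. w t > 0}"
      then have "0 < w t" by simp
      then have "t \<in> {a (w t)..b (w t)}" using iff[of "w t" t] w01[of t] by auto
      then show "t \<in> {a 0..b 0}"
        using mono[of 0 "w t"] w01[of t] by auto
    qed
    then show "closure {t. w t > 0} \<subseteq> {a 0..b 0}" by (intro closure_minimal) auto
    show "{a 0..b 0} \<subseteq> closure {t. w t > 0}"
    proof
      fix c assume c: "c \<in> {a 0..b 0}"
      have "\<exists>t. w t > 0 \<and> dist t c < e" if "e > 0" for e
      proof -
        obtain \<beta>1 where b1: "0 < \<beta>1" "\<beta>1 \<le> 1" "a \<beta>1 < a 0 + e" using zero(1)[of "a 0 + e"] \<open>e > 0\<close> by auto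
        obtain \<beta>2 where b2: "0 < \<beta>2" "\<beta>2 \<le> 1" "b 0 - e < b \<beta>2" using zero(2)[of "b 0 - e"] \<open>e > 0\<close> by auto
        define \<beta> where "\<beta> = min \<beta>1 \<beta>2"
        have be: "0 < \<beta>" "\<beta> \<le> 1" using b1 b2 by (auto simp: \<beta>_def)
        have "a \<beta> < a 0 + e" using mono(1)[of \<beta> \<beta>1] b1 b2 be by (auto simp: \<beta>_def)
        moreover have "b 0 - e < b \<beta>" using mono(2)[of \<beta> \<beta>2] b1 b2 be by (auto simp: \<beta>_def)
        moreover define t where "t = max (a \<beta>) (min (b \<beta>) c)"
        ultimately have "dist t c < e" "t \<in> {a \<beta>..b \<beta>}"
          using c le[of \<beta>] be \<open>e > 0\<close> by (auto simp: dist_real_def max_def min_def)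
        then show ?thesis using iff[OF be, of t] be by (intro exI[of _ t]) auto
      qed
      then show "c \<in> closure {t. w t > 0}" by (auto simp: closure_approachable)
    qed
  qed
  have "is_fuzzy_number w"
    unfolding is_fuzzy_number_def using w01 one conv usc clo compact_Icc by metis
  then have mem: "membership (Fuzzy w) = w" by (simp add: Fuzzy_inverse)
  have "\<forall>\<alpha>\<in>{0..1}. level (Fuzzy w) \<alpha> = {a \<alpha>..b \<alpha>}"
  proof
    fix \<alpha> :: real assume "\<alpha> \<in> {0..1}"
    then show "level (Fuzzy w) \<alpha> = {a \<alpha>..b \<alpha>}"
      using iff[of \<alpha>] clo by (cases "\<alpha> = 0") (auto simp: level_def mem)
  qed
  then show ?thesis
  proof (rule ex1I[of _ "Fuzzy w"])
    fix v assume "\<forall>\<alpha>\<in>{0..1}. level v \<alpha> = {a \<alpha>..b \<alpha>}"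
    with \<open>\<forall>\<alpha>\<in>{0..1}. level (Fuzzy w) \<alpha> = {a \<alpha>..b \<alpha>}\<close> show "v = Fuzzy w"
      by (intro fuzzy_eqI) simp
  qed
qed

text \<open>
  Addition and scalar multiplication are the fuzzy numbers described by their level sets; the
  lemmas \<open>ex1_plus\<close> and \<open>ex1_scaleR\<close> show that both definite descriptions are proper.
  Fuzzy numbers form a commutative monoid but not a vector space: there are no additive inverses,
  and \<open>(k + l) *\<^sub>R u = k *\<^sub>R u + l *\<^sub>R u\<close> can fail when \<open>k\<close> and \<open>l\<close> have opposite signs.
\<close>

instantiation fuzzy :: "{plus, zero, scaleR}"
begin

definition plus_fuzzy :: "fuzzy \<Rightarrow> fuzzy \<Rightarrow> fuzzy" where
  "u + v = (THE w. \<forall>\<alpha>\<in>{0..1}. level w \<alpha> = {lower u \<alpha> + lower v \<alpha>..upper u \<alpha> + upper v \<alpha>})"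

definition zero_fuzzy :: fuzzy where
  "0 = Fuzzy (\<lambda>t. if t = 0 then 1 else 0)"

definition scaleR_fuzzy :: "real \<Rightarrow> fuzzy \<Rightarrow> fuzzy" where
  "k *\<^sub>R u = (THE w. \<forall>\<alpha>\<in>{0..1}. level w \<alpha> = (\<lambda>t. k * t) ` level u \<alpha>)"

instance ..

end

lemma ex1_plus:
  "\<exists>!w. \<forall>\<alpha>\<in>{0..1}. level w \<alpha> = {lower u \<alpha> + lower v \<alpha>..upper u \<alpha> + upper v \<alpha>}"
proof (rule stacking)
  fix \<alpha> x :: real
  assume al: "0 < \<alpha>" "\<alpha> \<le> 1"
  {
    assume "x < lower u \<alpha> + lower v \<alpha>"
    then have "x - lower v \<alpha> < lower u \<alpha>" by simp
    then obtain z where z: "x - lower v \<alpha> < z" "z < lower u \<alpha>" using dense by blast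
    then have "x - z < lower v \<alpha>" by simp
    then obtain \<beta> where b: "0 < \<beta>" "\<beta> < \<alpha>" "x - z < lower v \<beta>"
      using lower_upper_left(1)[OF al] by blast
    obtain \<gamma> where c: "0 < \<gamma>" "\<gamma> < \<alpha>" "z < lower u \<gamma>"
      using lower_upper_left(1)[OF al z(2)] by blast
    show "\<exists>\<beta>. 0 < \<beta> \<and> \<beta> < \<alpha> \<and> x < lower u \<beta> + lower v \<beta>"
      using b c al lower_upper_mono(1)[of \<beta> "max \<beta> \<gamma>" v] lower_upper_mono(1)[of \<gamma> "max \<beta> \<gamma>" u]
      by (intro exI[of _ "max \<beta> \<gamma>"]) auto
  }
  {
    assume "upper u \<alpha> + upper v \<alpha> < x"
    then have "upper u \<alpha> < x - upper v \<alpha>" by simp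
    then obtain z where z: "z < x - upper v \<alpha>" "upper u \<alpha> < z" using dense by blast
    then have "upper v \<alpha> < x - z" by simp
    then obtain \<beta> where b: "0 < \<beta>" "\<beta> < \<alpha>" "upper v \<beta> < x - z"
      using lower_upper_left(2)[OF al] by blast
    obtain \<gamma> where c: "0 < \<gamma>" "\<gamma> < \<alpha>" "upper u \<gamma> < z"
      using lower_upper_left(2)[OF al z(2)] by blast
    show "\<exists>\<beta>. 0 < \<beta> \<and> \<beta> < \<alpha> \<and> upper u \<beta> + upper v \<beta> < x"
      using b c al lower_upper_mono(2)[of \<beta> "max \<beta> \<gamma>" v] lower_upper_mono(2)[of \<gamma> "max \<beta> \<gamma>" u]
      by (intro exI[of _ "max \<beta> \<gamma>"]) auto
  }
next
  fix x :: real
  {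
    assume "lower u 0 + lower v 0 < x"
    then have "lower u 0 < x - lower v 0" by simp
    then obtain z where z: "z < x - lower v 0" "lower u 0 < z" using dense by blast
    then have "lower v 0 < x - z" by simp
    then obtain \<beta> where b: "0 < \<beta>" "\<beta> \<le> 1" "lower v \<beta> < x - z"
      using lower_upper_zero(1) by blast
    obtain \<gamma> where c: "0 < \<gamma>" "\<gamma> \<le> 1" "lower u \<gamma> < z"
      using lower_upper_zero(1)[OF z(2)] by blast
    show "\<exists>\<beta>. 0 < \<beta> \<and> \<beta> \<le> 1 \<and> lower u \<beta> + lower v \<beta> < x"
      using b c lower_upper_mono(1)[of "min \<beta> \<gamma>" \<beta> v] lower_upper_mono(1)[of "min \<beta> \<gamma>" \<gamma> u]
      by (intro exI[of _ "min \<beta> \<gamma>"]) auto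
  }
  {
    assume "x < upper u 0 + upper v 0"
    then have "x - upper v 0 < upper u 0" by simp
    then obtain z where z: "x - upper v 0 < z" "z < upper u 0" using dense by blast
    then have "x - z < upper v 0" by simp
    then obtain \<beta> where b: "0 < \<beta>" "\<beta> \<le> 1" "x - z < upper v \<beta>"
      using lower_upper_zero(2) by blast
    obtain \<gamma> where c: "0 < \<gamma>" "\<gamma> \<le> 1" "z < upper u \<gamma>"
      using lower_upper_zero(2)[OF z(2)] by blast
    show "\<exists>\<beta>. 0 < \<beta> \<and> \<beta> \<le> 1 \<and> x < upper u \<beta> + upper v \<beta>"
      using b c lower_upper_mono(2)[of "min \<beta> \<gamma>" \<beta> v] lower_upper_mono(2)[of "min \<beta> \<gamma>" \<gamma> u]
      by (intro exI[of _ "min \<beta> \<gamma>"]) auto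
  }
qed (auto intro!: add_mono lower_upper_mono level_eq_interval)

lemma level_plus:
  assumes "\<alpha> \<in> {0..1}"
  shows "level (u + v) \<alpha> = {lower u \<alpha> + lower v \<alpha>..upper u \<alpha> + upper v \<alpha>}"
  using theI'[OF ex1_plus[of u v]] assms unfolding plus_fuzzy_def by blast

lemma ex1_scaleR: "\<exists>!w. \<forall>\<alpha>\<in>{0..1}. level w \<alpha> = (\<lambda>t. k * t) ` level u \<alpha>"
proof -
  define a where "a \<alpha> = (if k \<ge> 0 then k * lower u \<alpha> else k * upper u \<alpha>)" for \<alpha>
  define b where "b \<alpha> = (if k \<ge> 0 then k * upper u \<alpha> else k * lower u \<alpha>)" for \<alpha>
  have "(\<lambda>t. k * t) ` level u \<alpha> = {a \<alpha>..b \<alpha>}" if "\<alpha> \<in> {0..1}" for \<alpha>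
    using level_eq_interval[OF that, of u]
    by (simp add: a_def b_def image_mult_atLeastAtMost_if)
  moreover have "\<exists>!w. \<forall>\<alpha>\<in>{0..1}. level w \<alpha> = {a \<alpha>..b \<alpha>}"
  proof (cases "k = 0")
    case True
    have ab: "a \<alpha> = 0" "b \<alpha> = 0" for \<alpha>
      using True by (simp_all add: a_def b_def)
    have half: "\<exists>\<beta>. 0 < \<beta> \<and> \<beta> < \<alpha>" if "0 < \<alpha>" for \<alpha> :: real
      using that dense by blast
    have one: "\<exists>\<beta>::real. 0 < \<beta> \<and> \<beta> \<le> 1"
      by (intro exI[of _ 1]) simp
    show ?thesis
      by (rule stacking) (simp_all add: ab half one)
  next
    case False
    then consider "k > 0" | "k < 0" by linarith
    then show ?thesis
    proof cases
      case 1
      have ab: "a \<alpha> = k * lower u \<alpha>" "b \<alpha> = k * upper u \<alpha>" for \<alpha>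
        using 1 by (simp_all add: a_def b_def)
      have iff: "x < k * y \<longleftrightarrow> x / k < y" "k * y < x \<longleftrightarrow> y < x / k" for x y
        using 1 by (simp_all add: field_simps)
      show ?thesis
        unfolding ab
      proof (rule stacking)
        fix \<alpha> x :: real
        assume al: "0 < \<alpha>" "\<alpha> \<le> 1"
        show "x < k * lower u \<alpha> \<Longrightarrow> \<exists>\<beta>. 0 < \<beta> \<and> \<beta> < \<alpha> \<and> x < k * lower u \<beta>"
          unfolding iff by (rule lower_upper_left(1)[OF al])
        show "k * upper u \<alpha> < x \<Longrightarrow> \<exists>\<beta>. 0 < \<beta> \<and> \<beta> < \<alpha> \<and> k * upper u \<beta> < x"
          unfolding iff by (rule lower_upper_left(2)[OF al])
      next
        fix x :: real
        show "k * lower u 0 < x \<Longrightarrow> \<exists>\<beta>. 0 < \<beta> \<and> \<beta> \<le> 1 \<and> k * lower u \<beta> < x"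
          unfolding iff by (rule lower_upper_zero(1))
        show "x < k * upper u 0 \<Longrightarrow> \<exists>\<beta>. 0 < \<beta> \<and> \<beta> \<le> 1 \<and> x < k * upper u \<beta>"
          unfolding iff by (rule lower_upper_zero(2))
      qed (use 1 in \<open>simp_all add: lower_upper_mono level_eq_interval\<close>)
    next
      case 2
      have ab: "a \<alpha> = k * upper u \<alpha>" "b \<alpha> = k * lower u \<alpha>" for \<alpha>
        using 2 by (simp_all add: a_def b_def)
      have iff: "x < k * y \<longleftrightarrow> y < x / k" "k * y < x \<longleftrightarrow> x / k < y" for x y
        using 2 by (simp_all add: field_simps)
      show ?thesis
        unfolding ab
      proof (rule stacking)
        fix \<alpha> x :: real
        assume al: "0 < \<alpha>" "\<alpha> \<le> 1"
        show "x < k * upper u \<alpha> \<Longrightarrow> \<exists>\<beta>. 0 < \<beta> \<and> \<beta> < \<alpha> \<and> x < k * upper u \<beta>"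
          unfolding iff by (rule lower_upper_left(2)[OF al])
        show "k * lower u \<alpha> < x \<Longrightarrow> \<exists>\<beta>. 0 < \<beta> \<and> \<beta> < \<alpha> \<and> k * lower u \<beta> < x"
          unfolding iff by (rule lower_upper_left(1)[OF al])
      next
        fix x :: real
        show "k * upper u 0 < x \<Longrightarrow> \<exists>\<beta>. 0 < \<beta> \<and> \<beta> \<le> 1 \<and> k * upper u \<beta> < x"
          unfolding iff by (rule lower_upper_zero(2))
        show "x < k * lower u 0 \<Longrightarrow> \<exists>\<beta>. 0 < \<beta> \<and> \<beta> \<le> 1 \<and> x < k * lower u \<beta>"
          unfolding iff by (rule lower_upper_zero(1))
      qed (use 2 in \<open>simp_all add: lower_upper_mono level_eq_interval\<close>)
    qed
  qed
  ultimately show ?thesis by simp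
qed

lemma level_scaleR:
  assumes "\<alpha> \<in> {0..1}"
  shows "level (k *\<^sub>R u) \<alpha> = (\<lambda>t. k * t) ` level u \<alpha>"
  using theI'[OF ex1_scaleR[of k u]] assms unfolding scaleR_fuzzy_def by blast

lemma lower_upper_plus:
  assumes "\<alpha> \<in> {0..1}"
  shows "lower (u + v) \<alpha> = lower u \<alpha> + lower v \<alpha>" "upper (u + v) \<alpha> = upper u \<alpha> + upper v \<alpha>"
  using level_plus[OF assms, of u v] level_eq_interval[OF assms, of u] level_eq_interval[OF assms, of v]
  by (simp_all add: lower_def[of "u + v"] upper_def[of "u + v"])

lemma lower_upper_0:
  assumes "\<alpha> \<in> {0..1}"
  shows "lower 0 \<alpha> = 0" "upper 0 \<alpha> = 0"
proof -
  have "membership 0 = (\<lambda>t. if t = 0 then 1 else 0)"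
    using is_fuzzy_number_crisp[of 0] by (simp add: zero_fuzzy_def Fuzzy_inverse)
  then have "level 0 \<alpha> = closure {0}"
    using assms by (auto simp: level_def intro!: arg_cong[where f = closure])
  then show "lower 0 \<alpha> = 0" "upper 0 \<alpha> = 0"
    by (simp_all add: lower_def upper_def)
qed

instance fuzzy :: comm_monoid_add
  by intro_classes (rule fuzzy_eqI2; simp add: lower_upper_plus lower_upper_0)+

lemma bdd_above_dist:
  "bdd_above ((\<lambda>\<alpha>. max \<bar>lower u \<alpha> - lower v \<alpha>\<bar> \<bar>upper u \<alpha> - upper v \<alpha>\<bar>) ` {0..1})"
proof (rule bdd_aboveI2)
  fix \<alpha> :: real assume "\<alpha> \<in> {0..1}"
  then show "max \<bar>lower u \<alpha> - lower v \<alpha>\<bar> \<bar>upper u \<alpha> - upper v \<alpha>\<bar>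
      \<le> \<bar>lower u 0\<bar> + \<bar>upper u 0\<bar> + \<bar>lower v 0\<bar> + \<bar>upper v 0\<bar>"
    using lower_upper_mono[of 0 \<alpha> u] lower_upper_mono[of 0 \<alpha> v]
      level_eq_interval(2)[of \<alpha> u] level_eq_interval(2)[of \<alpha> v] by auto
qed

instantiation fuzzy :: metric_space
begin

definition dist_fuzzy :: "fuzzy \<Rightarrow> fuzzy \<Rightarrow> real" where
  "dist u v = (SUP \<alpha>\<in>{0..1}. max \<bar>lower u \<alpha> - lower v \<alpha>\<bar> \<bar>upper u \<alpha> - upper v \<alpha>\<bar>)"

definition uniformity_fuzzy :: "(fuzzy \<times> fuzzy) filter" where
  "uniformity_fuzzy = (INF e\<in>{0<..}. principal {(x, y). dist x y < e})"

definition open_fuzzy :: "fuzzy set \<Rightarrow> bool" where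
  "open_fuzzy U = (\<forall>x\<in>U. \<forall>\<^sub>F (x', y) in uniformity. x' = x \<longrightarrow> y \<in> U)"

instance
proof
  fix x y z :: fuzzy
  have ub: "max \<bar>lower u \<alpha> - lower v \<alpha>\<bar> \<bar>upper u \<alpha> - upper v \<alpha>\<bar> \<le> dist u v"
    if "\<alpha> \<in> {0..1}" for u v \<alpha>
    unfolding dist_fuzzy_def using that by (intro cSUP_upper bdd_above_dist)
  show "(dist x y = 0) = (x = y)"
  proof
    assume "dist x y = 0"
    then show "x = y"
      using ub[of _ x y] by (intro fuzzy_eqI2) fastforce+
  next
    assume "x = y"
    then show "dist x y = 0" by (simp add: dist_fuzzy_def)
  qed
  show "dist x y \<le> dist x z + dist y z"
    unfolding dist_fuzzy_def[of x y]
  proof (rule cSUP_least)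
    fix \<alpha> :: real assume "\<alpha> \<in> {0..1}"
    then show "max \<bar>lower x \<alpha> - lower y \<alpha>\<bar> \<bar>upper x \<alpha> - upper y \<alpha>\<bar> \<le> dist x z + dist y z"
      using ub[of \<alpha> x z] ub[of \<alpha> y z] by auto
  qed simp
qed (rule uniformity_fuzzy_def open_fuzzy_def)+

end

definition euler_mean :: "real \<Rightarrow> (nat \<Rightarrow> fuzzy) \<Rightarrow> nat \<Rightarrow> fuzzy" where
  "euler_mean p u n =
     (1 / (p + 1) ^ n) *\<^sub>R (\<Sum>k=0..n. (real (n choose k) * p ^ (n - k)) *\<^sub>R u k)"

definition euler_summable_to :: "real \<Rightarrow> (nat \<Rightarrow> fuzzy) \<Rightarrow> fuzzy \<Rightarrow> bool" where
  "euler_summable_to p u \<mu> \<longleftrightarrow> euler_mean p u \<longlonglongrightarrow> \<mu>"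

text \<open>The series is taken in the metric space of fuzzy numbers through \<^const>\<open>summable\<close> and
  \<^const>\<open>suminf\<close>, which only need a topology and a commutative monoid.\<close>

definition borel_summable_to :: "(nat \<Rightarrow> fuzzy) \<Rightarrow> fuzzy \<Rightarrow> bool" where
  "borel_summable_to u \<mu> \<longleftrightarrow>
     (\<forall>x>0. summable (\<lambda>n. (x ^ n / fact n) *\<^sub>R u n)) \<and>
     ((\<lambda>x::real. exp (- x) *\<^sub>R (\<Sum>n. (x ^ n / fact n) *\<^sub>R u n)) \<longlongrightarrow> \<mu>) at_top"

end

theory Submission
  imports Defs "HOL-Computational_Algebra.Formal_Power_Series"
begin

text \<open>
  Passing from coefficients to exponential generating functions turns the Euler transform into
  multiplication by an exponential. If a real sequence \<open>a\<close> has Euler means \<open>t\<close>, then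
  \[\sum_n \frac{((p+1)x)^n}{n!}\,t_n = e^{px} \sum_n \frac{x^n}{n!}\,a_n,\]
  so that with \<open>y = (p + 1) x\<close> the Borel mean of \<open>a\<close> at \<open>x\<close> is the Borel mean of \<open>t\<close> at \<open>y\<close>
  (lemma \<open>borel_series_euler_mean\<close>). As the Borel method preserves limits of convergent sequences,
  convergence of \<open>t\<close> to \<open>m\<close> carries over to the Borel means of \<open>a\<close>.

  For fuzzy numbers this is applied to the end points of each level set, which depend additively
  on the fuzzy number and homogeneously as long as the scalars are nonnegative; all scalars in the
  Euler and Borel means are. What has to be controlled is uniformity in the level. The error of the
  Borel mean of \<open>a\<close> is therefore bounded by the Borel mean of any sequence \<open>d\<close> that dominates
  \<open>\<bar>t n - m\<bar>\<close> (lemma \<open>borel_mean_error_bound\<close>); the distances \<open>d n\<close> between the fuzzy Euler means and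
  \<open>\<mu>\<close> serve at all levels at once, and they tend to \<open>0\<close>.

  Convergence of the Borel series must also be proved, since the individual \<open>u n\<close> are not bounded
  in general. Inverting the Euler transform gives \<open>\<bar>a n\<bar> \<le> M * (2 * p + 1) ^ n\<close> with a constant \<open>M\<close>
  that does not depend on the level (lemma \<open>euler_mean_bound_terms\<close>). Hence the Borel series is
  dominated by an exponential series, and the completeness of the space of fuzzy numbers yields
  its sum.
\<close>

section \<open>Euler and Borel means of real sequences\<close>

definition real_euler_mean :: "real \<Rightarrow> (nat \<Rightarrow> real) \<Rightarrow> nat \<Rightarrow> real" where
  "real_euler_mean p a n = (\<Sum>k=0..n. real (n choose k) * p ^ (n - k) * a k) / (p + 1) ^ n"

lemma exp_sums_fact: "(\<lambda>n. x ^ n / fact n) sums exp (x::real)"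
  using exp_converges[of x] by (simp add: divide_inverse mult.commute)

text \<open>
  Dividing by \<open>n!\<close> turns the binomial sum into a convolution: the coefficients of the product of
  the exponential generating function of \<open>a\<close> with \<open>exp (p x)\<close>.
\<close>

lemma euler_mean_coeff:
  fixes p :: real
  assumes "p > 0"
  shows "(p + 1) ^ n * real_euler_mean p a n / fact n =
    (\<Sum>k=0..n. a k / fact k * (p ^ (n - k) / fact (n - k)))"
proof -
  have "(p + 1) ^ n * real_euler_mean p a n = (\<Sum>k=0..n. real (n choose k) * p ^ (n - k) * a k)"
    using assms by (simp add: real_euler_mean_def)
  then have "(p + 1) ^ n * real_euler_mean p a n / fact n =
      (\<Sum>k=0..n. real (n choose k) * p ^ (n - k) * a k / fact n)"
    by (simp add: sum_divide_distrib)
  also have "\<dots> = (\<Sum>k=0..n. a k / fact k * (p ^ (n - k) / fact (n - k)))"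
  proof (rule sum.cong)
    fix k assume "k \<in> {0..n}"
    then show "real (n choose k) * p ^ (n - k) * a k / fact n =
        a k / fact k * (p ^ (n - k) / fact (n - k))"
      by (simp add: binomial_fact field_simps)
  qed simp
  finally show ?thesis .
qed

text \<open>
  The Euler transform is inverted by multiplying the generating function by \<open>exp (- p x)\<close>, which
  is done with formal power series because nothing is known yet about convergence. In absolute
  value this costs a factor \<open>exp (p x)\<close> beyond the \<open>exp ((p + 1) x)\<close> that dominates the generating
  function of the Euler means, whence the base \<open>2 * p + 1\<close>.
\<close>

lemma euler_mean_bound_terms:
  assumes p: "p > 0" and M: "\<And>n. \<bar>real_euler_mean p a n\<bar> \<le> M"
  shows "\<bar>a n\<bar> \<le> M * (2 * p + 1) ^ n"
proof -
  define A where "A = Abs_fps (\<lambda>n. a n / fact n)"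
  define T where "T = Abs_fps (\<lambda>n. (p + 1) ^ n * real_euler_mean p a n / fact n)"
  have "T = A * fps_exp p"
    by (rule fps_ext) (simp add: T_def A_def fps_mult_nth euler_mean_coeff[OF p])
  then have "T * fps_exp (- p) = A * (fps_exp p * fps_exp (- p))"
    by (simp add: mult.assoc)
  then have A: "A = T * fps_exp (- p)"
    by (simp flip: fps_exp_add_mult)
  have "\<bar>a n\<bar> / fact n = \<bar>fps_nth A n\<bar>"
    by (simp add: A_def)
  also have "\<dots> = \<bar>\<Sum>i=0..n. (p + 1) ^ i * real_euler_mean p a i / fact i
      * ((- p) ^ (n - i) / fact (n - i))\<bar>"
    by (simp add: A fps_mult_nth) (simp add: T_def)
  also have "\<dots> \<le> (\<Sum>i=0..n. M * ((p + 1) ^ i / fact i * (p ^ (n - i) / fact (n - i))))"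
  proof (rule order.trans[OF sum_abs sum_mono])
    fix i
    have "\<bar>(p + 1) ^ i * real_euler_mean p a i / fact i * ((- p) ^ (n - i) / fact (n - i))\<bar> =
        \<bar>real_euler_mean p a i\<bar> * ((p + 1) ^ i / fact i * (p ^ (n - i) / fact (n - i)))"
      using p by (simp add: abs_mult power_abs)
    also have "\<dots> \<le> M * ((p + 1) ^ i / fact i * (p ^ (n - i) / fact (n - i)))"
      using p by (intro mult_right_mono M) simp
    finally show "\<bar>(p + 1) ^ i * real_euler_mean p a i / fact i * ((- p) ^ (n - i) / fact (n - i))\<bar>
        \<le> M * ((p + 1) ^ i / fact i * (p ^ (n - i) / fact (n - i)))" .
  qed
  also have "\<dots> = M * fps_nth (fps_exp (p + 1) * fps_exp p) n"
    by (simp add: fps_mult_nth sum_distrib_left)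
  also have "\<dots> = M * (2 * p + 1) ^ n / fact n"
    by (simp add: algebra_simps flip: fps_exp_add_mult)
  finally show ?thesis
    by (simp add: divide_le_cancel)
qed

lemma summable_exp_bounded:
  fixes a :: "nat \<Rightarrow> real"
  assumes "\<And>n. \<bar>a n\<bar> \<le> M * r ^ n"
  shows "summable (\<lambda>n. \<bar>x ^ n / fact n * a n\<bar>)"
proof (rule summable_comparison_test')
  show "summable (\<lambda>n. M * (inverse (fact n) * (\<bar>x\<bar> * r) ^ n))"
    by (intro summable_mult summable_exp)
  show "norm \<bar>x ^ n / fact n * a n\<bar> \<le> M * (inverse (fact n) * (\<bar>x\<bar> * r) ^ n)" for n
    using mult_left_mono[OF assms[of n], of "\<bar>x\<bar> ^ n / fact n"]
    by (simp add: abs_mult power_abs field_simps)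
qed

text \<open>
  The analytic counterpart of the convolution identity: the growth bound makes the Borel series of
  \<open>a\<close> absolutely convergent, so its Cauchy product with the exponential series may be formed.
\<close>

lemma borel_series_euler_mean:
  assumes p: "p > 0" and M: "\<And>n. \<bar>real_euler_mean p a n\<bar> \<le> M"
  shows "(\<lambda>n. ((p + 1) * x) ^ n / fact n * real_euler_mean p a n) sums
    (exp (p * x) * (\<Sum>n. x ^ n / fact n * a n))"
proof -
  have sa: "summable (\<lambda>n. norm (x ^ n / fact n * a n))"
    unfolding real_norm_def by (rule summable_exp_bounded, rule euler_mean_bound_terms[OF p M])
  have se: "summable (\<lambda>n. norm ((p * x) ^ n / fact n))"
    using summable_norm_exp[of "p * x"] by (simp add: divide_inverse mult.commute)
  have "exp (p * x) = (\<Sum>n. (p * x) ^ n / fact n)"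
    by (rule sums_unique[OF exp_sums_fact])
  moreover have "(\<Sum>k\<le>n. (x ^ k / fact k * a k) * ((p * x) ^ (n - k) / fact (n - k))) =
      ((p + 1) * x) ^ n / fact n * real_euler_mean p a n" for n
  proof -
    have "(\<Sum>k\<le>n. (x ^ k / fact k * a k) * ((p * x) ^ (n - k) / fact (n - k))) =
        (\<Sum>k=0..n. x ^ n * (a k / fact k * (p ^ (n - k) / fact (n - k))))"
    proof (rule sum.cong)
      fix k assume "k \<in> {0..n}"
      then have "x ^ n = x ^ k * x ^ (n - k)" by (simp flip: power_add)
      then show "(x ^ k / fact k * a k) * ((p * x) ^ (n - k) / fact (n - k)) =
          x ^ n * (a k / fact k * (p ^ (n - k) / fact (n - k)))"
        by (simp add: power_mult_distrib)
    qed auto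
    also have "\<dots> = x ^ n * ((p + 1) ^ n * real_euler_mean p a n / fact n)"
      by (simp add: euler_mean_coeff[OF p] sum_distrib_left)
    finally show ?thesis by (simp add: power_mult_distrib)
  qed
  ultimately show ?thesis
    using Cauchy_product_sums[OF sa se] by (simp add: mult.commute)
qed

text \<open>
  The right-hand side depends on \<open>a\<close> and \<open>m\<close> only through the dominating sequence \<open>d\<close>; this is what
  makes the estimate uniform over all end points of all level sets.
\<close>

lemma borel_mean_error_bound:
  assumes p: "p > 0" and d: "\<And>n. \<bar>real_euler_mean p a n - m\<bar> \<le> d n" "\<And>n. d n \<le> K"
  shows "\<bar>exp (- x) * (\<Sum>n. x ^ n / fact n * a n) - m\<bar> \<le>
    exp (- ((p + 1) * x)) * (\<Sum>n. \<bar>(p + 1) * x\<bar> ^ n / fact n * d n)"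
proof -
  let ?y = "(p + 1) * x"
  have "\<bar>real_euler_mean p a n\<bar> \<le> K + \<bar>m\<bar>" for n
    using d(1)[of n] d(2)[of n] by linarith
  from borel_series_euler_mean[OF p this, of x]
  have T: "(\<lambda>n. ?y ^ n / fact n * real_euler_mean p a n) sums
    (exp (p * x) * (\<Sum>n. x ^ n / fact n * a n))" .
  have "(\<lambda>n. ?y ^ n / fact n * m) sums (exp ?y * m)"
    by (rule sums_mult2[OF exp_sums_fact])
  from sums_diff[OF T this]
  have D: "(\<lambda>n. ?y ^ n / fact n * (real_euler_mean p a n - m)) sums
    (exp (p * x) * (\<Sum>n. x ^ n / fact n * a n) - exp ?y * m)"
    by (simp add: right_diff_distrib)
  have dn: "\<bar>d n\<bar> \<le> K * 1 ^ n" for n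
    using d(1)[of n] d(2)[of n] by simp
  have sd: "summable (\<lambda>n. \<bar>?y\<bar> ^ n / fact n * d n)"
    using summable_exp_bounded[OF dn, of "\<bar>?y\<bar>"] by (rule summable_rabs_cancel)
  have le: "norm (?y ^ n / fact n * (real_euler_mean p a n - m)) \<le> \<bar>?y\<bar> ^ n / fact n * d n" for n
  proof -
    have "norm (?y ^ n / fact n * (real_euler_mean p a n - m)) =
        \<bar>?y\<bar> ^ n / fact n * \<bar>real_euler_mean p a n - m\<bar>"
      unfolding real_norm_def abs_mult abs_divide power_abs by simp
    also have "\<dots> \<le> \<bar>?y\<bar> ^ n / fact n * d n"
      by (intro mult_left_mono d) simp
    finally show ?thesis .
  qed
  have "exp (- x) = exp (- ?y) * exp (p * x)"
    by (simp add: algebra_simps flip: exp_add)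
  then have "exp (- x) * (\<Sum>n. x ^ n / fact n * a n) - m =
      exp (- ?y) * (exp (p * x) * (\<Sum>n. x ^ n / fact n * a n) - exp ?y * m)"
    by (simp add: right_diff_distrib flip: exp_add mult.assoc)
  also have "\<bar>\<dots>\<bar> = exp (- ?y) * \<bar>\<Sum>n. ?y ^ n / fact n * (real_euler_mean p a n - m)\<bar>"
    using sums_unique[OF D] by (simp add: abs_mult)
  also have "\<dots> \<le> exp (- ?y) * (\<Sum>n. \<bar>?y\<bar> ^ n / fact n * d n)"
    using norm_suminf_le[OF le sd] by simp
  finally show ?thesis .
qed

text \<open>
  The weights \<open>exp (- y) * y ^ n / n!\<close> have sum \<open>1\<close>, and each of them vanishes as \<open>y\<close> grows. So
  finitely many initial terms contribute nothing in the limit, and the remaining ones contribute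
  at most their supremum.
\<close>

lemma borel_regular_null:
  fixes d :: "nat \<Rightarrow> real"
  assumes d: "d \<longlonglongrightarrow> 0"
  shows "((\<lambda>y. exp (- y) * (\<Sum>n. y ^ n / fact n * d n)) \<longlongrightarrow> 0) at_top"
proof (rule tendstoI)
  fix e :: real assume e: "e > 0"
  obtain K where K: "\<And>n. \<bar>d n\<bar> \<le> K"
    using convergent_imp_Bseq[OF convergentI[OF d]] by (auto simp: Bseq_def)
  obtain N where N: "\<And>n. n \<ge> N \<Longrightarrow> \<bar>d n\<bar> < e / 2"
    using LIMSEQ_D[OF d, of "e / 2"] e by auto
  have "((\<lambda>y. \<Sum>n<N. y ^ n / exp y * (K / fact n)) \<longlongrightarrow> (\<Sum>n<N. 0 * (K / fact n))) at_top"
    by (intro tendsto_intros tendsto_power_div_exp_0)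
  then have "\<forall>\<^sub>F y in at_top. \<bar>\<Sum>n<N. y ^ n / exp y * (K / fact n)\<bar> < e / 2"
    using e by (auto dest!: tendstoD[where e = "e / 2"])
  then show "\<forall>\<^sub>F y in at_top. dist (exp (- y) * (\<Sum>n. y ^ n / fact n * d n)) 0 < e"
    using eventually_ge_at_top[of 0]
  proof eventually_elim
    fix y :: real
    assume y: "\<bar>\<Sum>n<N. y ^ n / exp y * (K / fact n)\<bar> < e / 2" "0 \<le> y"
    have dn: "\<bar>d n\<bar> \<le> K * 1 ^ n" for n using K by simp
    \<comment> \<open>The terms with \<open>n < N\<close> are charged to \<open>K\<close>, all others to \<open>e / 2\<close>.\<close>
    define c where "c n = (if n < N then y ^ n / fact n * K else 0)" for n
    have c: "c sums (\<Sum>n<N. y ^ n / fact n * K)"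
      using sums_If_finite_set[of "{..<N}" "\<lambda>n. y ^ n / fact n * K"]
      by (simp add: c_def[abs_def])
    have E: "(\<lambda>n. y ^ n / fact n * (e / 2)) sums (exp y * (e / 2))"
      by (rule sums_mult2[OF exp_sums_fact])
    have le: "norm (y ^ n / fact n * d n) \<le> c n + y ^ n / fact n * (e / 2)" for n
    proof -
      have "\<bar>d n\<bar> \<le> (if n < N then K else 0) + e / 2"
        using K[of n] N[of n] e by auto
      then have "y ^ n / fact n * \<bar>d n\<bar> \<le> y ^ n / fact n * ((if n < N then K else 0) + e / 2)"
        using y by (intro mult_left_mono) auto
      then show ?thesis
        using y by (simp add: abs_mult c_def distrib_left split: if_splits)
    qed
    have "\<bar>\<Sum>n. y ^ n / fact n * d n\<bar> \<le> (\<Sum>n<N. y ^ n / fact n * K) + exp y * (e / 2)"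
      using norm_suminf_le[OF le sums_summable[OF sums_add[OF c E]]]
      unfolding sums_unique[OF sums_add[OF c E], symmetric] real_norm_def .
    then have "exp (- y) * \<bar>\<Sum>n. y ^ n / fact n * d n\<bar> \<le>
        exp (- y) * ((\<Sum>n<N. y ^ n / fact n * K) + exp y * (e / 2))"
      by (intro mult_left_mono) auto
    also have "\<dots> = (\<Sum>n<N. y ^ n / exp y * (K / fact n)) + e / 2"
      by (simp add: distrib_left sum_distrib_left exp_minus field_simps)
    also have "\<dots> < e" using y by linarith
    finally show "dist (exp (- y) * (\<Sum>n. y ^ n / fact n * d n)) 0 < e"
      by (simp add: abs_mult)
  qed
qed

section \<open>The metric space of fuzzy numbers\<close>

lemma endpoint_dist_le:
  assumes "\<alpha> \<in> {0..1}"
  shows "\<bar>lower u \<alpha> - lower v \<alpha>\<bar> \<le> dist u v" "\<bar>upper u \<alpha> - upper v \<alpha>\<bar> \<le> dist u v"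
proof -
  have "max \<bar>lower u \<alpha> - lower v \<alpha>\<bar> \<bar>upper u \<alpha> - upper v \<alpha>\<bar> \<le> dist u v"
    unfolding dist_fuzzy_def using assms by (intro cSUP_upper bdd_above_dist)
  then show "\<bar>lower u \<alpha> - lower v \<alpha>\<bar> \<le> dist u v" "\<bar>upper u \<alpha> - upper v \<alpha>\<bar> \<le> dist u v"
    by auto
qed

lemma dist_fuzzy_leI:
  assumes "\<And>\<alpha>. \<alpha> \<in> {0..1} \<Longrightarrow> \<bar>lower u \<alpha> - lower v \<alpha>\<bar> \<le> B"
    and "\<And>\<alpha>. \<alpha> \<in> {0..1} \<Longrightarrow> \<bar>upper u \<alpha> - upper v \<alpha>\<bar> \<le> B"
  shows "dist u v \<le> B"
  unfolding dist_fuzzy_def using assms by (intro cSUP_least) auto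

text \<open>
  The conditions that characterise the end points of a fuzzy number, namely order, monotonicity,
  left continuity on \<open>(0, 1]\<close> and right continuity at \<open>0\<close>, survive uniform limits. They are all
  consequences of strict inequalities: if one of them concerns a gap \<open>x < y\<close>, an approximation
  better than half of the gap suffices.
\<close>

lemma fuzzy_of_uniform_limits:
  fixes a b :: "real \<Rightarrow> real"
  assumes near: "\<And>e. e > 0 \<Longrightarrow>
    \<exists>u. \<forall>\<alpha>\<in>{0..1}. \<bar>lower u \<alpha> - a \<alpha>\<bar> < e \<and> \<bar>upper u \<alpha> - b \<alpha>\<bar> < e"
  obtains w where "\<And>\<alpha>. \<alpha> \<in> {0..1} \<Longrightarrow> lower w \<alpha> = a \<alpha>" "\<And>\<alpha>. \<alpha> \<in> {0..1} \<Longrightarrow> upper w \<alpha> = b \<alpha>"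
proof -
  have approx: "\<exists>u. (\<forall>\<alpha>. 0 \<le> \<alpha> \<longrightarrow> \<alpha> \<le> 1 \<longrightarrow> lower u \<alpha> < a \<alpha> + (y - x) / 2) \<and>
      (\<forall>\<alpha>. 0 \<le> \<alpha> \<longrightarrow> \<alpha> \<le> 1 \<longrightarrow> a \<alpha> < lower u \<alpha> + (y - x) / 2) \<and>
      (\<forall>\<alpha>. 0 \<le> \<alpha> \<longrightarrow> \<alpha> \<le> 1 \<longrightarrow> upper u \<alpha> < b \<alpha> + (y - x) / 2) \<and>
      (\<forall>\<alpha>. 0 \<le> \<alpha> \<longrightarrow> \<alpha> \<le> 1 \<longrightarrow> b \<alpha> < upper u \<alpha> + (y - x) / 2)" if "x < y" for x y
  proof -
    have "(y - x) / 2 > 0" using that by simp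
    from near[OF this] obtain u where
      u: "\<forall>\<alpha>\<in>{0..1}. \<bar>lower u \<alpha> - a \<alpha>\<bar> < (y - x) / 2 \<and> \<bar>upper u \<alpha> - b \<alpha>\<bar> < (y - x) / 2"
      by (rule exE)
    have "lower u \<alpha> < a \<alpha> + (y - x) / 2" "a \<alpha> < lower u \<alpha> + (y - x) / 2"
      "upper u \<alpha> < b \<alpha> + (y - x) / 2" "b \<alpha> < upper u \<alpha> + (y - x) / 2"
      if "0 \<le> \<alpha>" "\<alpha> \<le> 1" for \<alpha>
    proof -
      have "\<bar>lower u \<alpha> - a \<alpha>\<bar> < (y - x) / 2" "\<bar>upper u \<alpha> - b \<alpha>\<bar> < (y - x) / 2"
        using u that by simp_all
      then show "lower u \<alpha> < a \<alpha> + (y - x) / 2" "a \<alpha> < lower u \<alpha> + (y - x) / 2"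
        "upper u \<alpha> < b \<alpha> + (y - x) / 2" "b \<alpha> < upper u \<alpha> + (y - x) / 2"
        unfolding abs_less_iff by linarith+
    qed
    then show ?thesis by (intro exI[of _ u] conjI allI impI)
  qed
  have le: "a \<alpha> \<le> b \<alpha>" if al: "0 \<le> \<alpha>" "\<alpha> \<le> 1" for \<alpha>
  proof (rule ccontr)
    assume "\<not> ?thesis"
    then have lt: "b \<alpha> < a \<alpha>" by simp
    obtain u where "a \<alpha> < lower u \<alpha> + (a \<alpha> - b \<alpha>) / 2" "upper u \<alpha> < b \<alpha> + (a \<alpha> - b \<alpha>) / 2"
      using approx[OF lt] al by blast
    moreover have "lower u \<alpha> \<le> upper u \<alpha>" using level_eq_interval(2) al by simp
    ultimately show False by argo
  qed
  have mono_a: "a \<alpha> \<le> a \<beta>" if al: "0 \<le> \<alpha>" "\<alpha> \<le> \<beta>" "\<beta> \<le> 1" for \<alpha> \<beta>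
  proof (rule ccontr)
    assume "\<not> ?thesis"
    then have lt: "a \<beta> < a \<alpha>" by simp
    obtain u where "a \<alpha> < lower u \<alpha> + (a \<alpha> - a \<beta>) / 2" "lower u \<beta> < a \<beta> + (a \<alpha> - a \<beta>) / 2"
      using approx[OF lt] al by (meson order_trans)
    moreover have "lower u \<alpha> \<le> lower u \<beta>" using lower_upper_mono(1) al by simp
    ultimately show False by argo
  qed
  have mono_b: "b \<beta> \<le> b \<alpha>" if al: "0 \<le> \<alpha>" "\<alpha> \<le> \<beta>" "\<beta> \<le> 1" for \<alpha> \<beta>
  proof (rule ccontr)
    assume "\<not> ?thesis"
    then have lt: "b \<alpha> < b \<beta>" by simp
    obtain u where "b \<beta> < upper u \<beta> + (b \<beta> - b \<alpha>) / 2" "upper u \<alpha> < b \<alpha> + (b \<beta> - b \<alpha>) / 2"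
      using approx[OF lt] al by (meson order_trans)
    moreover have "upper u \<beta> \<le> upper u \<alpha>" using lower_upper_mono(2) al by simp
    ultimately show False by argo
  qed
  have left_a: "\<exists>\<beta>. 0 < \<beta> \<and> \<beta> < \<alpha> \<and> x < a \<beta>" if al: "0 < \<alpha>" "\<alpha> \<le> 1" and x: "x < a \<alpha>" for \<alpha> x
  proof -
    define e where "e = (a \<alpha> - x) / 2"
    obtain u where u: "a \<alpha> < lower u \<alpha> + e" "\<forall>\<beta>. 0 \<le> \<beta> \<longrightarrow> \<beta> \<le> 1 \<longrightarrow> lower u \<beta> < a \<beta> + e"
      using approx[OF x] al unfolding e_def by (meson less_imp_le)
    have "x + e < lower u \<alpha>" using u(1) by (simp add: e_def field_simps)
    then obtain \<beta> where "0 < \<beta>" "\<beta> < \<alpha>" "x + e < lower u \<beta>"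
      using lower_upper_left(1)[OF al] by blast
    then show ?thesis using u(2)[rule_format, of \<beta>] al by (intro exI[of _ \<beta>]) auto
  qed
  have left_b: "\<exists>\<beta>. 0 < \<beta> \<and> \<beta> < \<alpha> \<and> b \<beta> < x" if al: "0 < \<alpha>" "\<alpha> \<le> 1" and x: "b \<alpha> < x" for \<alpha> x
  proof -
    define e where "e = (x - b \<alpha>) / 2"
    obtain u where u: "upper u \<alpha> < b \<alpha> + e" "\<forall>\<beta>. 0 \<le> \<beta> \<longrightarrow> \<beta> \<le> 1 \<longrightarrow> b \<beta> < upper u \<beta> + e"
      using approx[OF x] al unfolding e_def by (meson less_imp_le)
    have "upper u \<alpha> < x - e" using u(1) by (simp add: e_def field_simps)
    then obtain \<beta> where "0 < \<beta>" "\<beta> < \<alpha>" "upper u \<beta> < x - e"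
      using lower_upper_left(2)[OF al] by blast
    then show ?thesis using u(2)[rule_format, of \<beta>] al by (intro exI[of _ \<beta>]) auto
  qed
  have zero_a: "\<exists>\<beta>. 0 < \<beta> \<and> \<beta> \<le> 1 \<and> a \<beta> < x" if x: "a 0 < x" for x
  proof -
    define e where "e = (x - a 0) / 2"
    obtain u where u: "lower u 0 < a 0 + e" "\<forall>\<beta>. 0 \<le> \<beta> \<longrightarrow> \<beta> \<le> 1 \<longrightarrow> a \<beta> < lower u \<beta> + e"
      using approx[OF x] unfolding e_def by (meson order_refl zero_le_one)
    have "lower u 0 < x - e" using u(1) by (simp add: e_def field_simps)
    then obtain \<beta> where "0 < \<beta>" "\<beta> \<le> 1" "lower u \<beta> < x - e"
      using lower_upper_zero(1) by blast
    then show ?thesis using u(2)[rule_format, of \<beta>] by (intro exI[of _ \<beta>]) auto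
  qed
  have zero_b: "\<exists>\<beta>. 0 < \<beta> \<and> \<beta> \<le> 1 \<and> x < b \<beta>" if x: "x < b 0" for x
  proof -
    define e where "e = (b 0 - x) / 2"
    obtain u where u: "b 0 < upper u 0 + e" "\<forall>\<beta>. 0 \<le> \<beta> \<longrightarrow> \<beta> \<le> 1 \<longrightarrow> upper u \<beta> < b \<beta> + e"
      using approx[OF x] unfolding e_def by (meson order_refl zero_le_one)
    have "x + e < upper u 0" using u(1) by (simp add: e_def field_simps)
    then obtain \<beta> where "0 < \<beta>" "\<beta> \<le> 1" "x + e < upper u \<beta>"
      using lower_upper_zero(2) by blast
    then show ?thesis using u(2)[rule_format, of \<beta>] by (intro exI[of _ \<beta>]) auto
  qed
  have "\<exists>!w. \<forall>\<alpha>\<in>{0..1}. level w \<alpha> = {a \<alpha>..b \<alpha>}"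
    by (rule stacking) (fact le mono_a mono_b left_a left_b zero_a zero_b)+
  then obtain w where w: "\<And>\<alpha>. \<alpha> \<in> {0..1} \<Longrightarrow> level w \<alpha> = {a \<alpha>..b \<alpha>}"
    by blast
  show ?thesis
  proof (rule that)
    fix \<alpha> :: real assume al: "\<alpha> \<in> {0..1}"
    then have "a \<alpha> \<le> b \<alpha>" using le by simp
    then show "lower w \<alpha> = a \<alpha>" "upper w \<alpha> = b \<alpha>"
      by (simp_all add: lower_def upper_def w[OF al])
  qed
qed

text \<open>
  The metric is uniform convergence of both end points over the levels, so a Cauchy sequence has
  uniform limits of its end points, and those belong to a fuzzy number.
\<close>

instance fuzzy :: complete_space
proof
  fix X :: "nat \<Rightarrow> fuzzy"
  assume C: "Cauchy X"
  define a where "a \<alpha> = lim (\<lambda>n. lower (X n) \<alpha>)" for \<alpha>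
  define b where "b \<alpha> = lim (\<lambda>n. upper (X n) \<alpha>)" for \<alpha>
  have lim: "(\<lambda>n. lower (X n) \<alpha>) \<longlonglongrightarrow> a \<alpha>" "(\<lambda>n. upper (X n) \<alpha>) \<longlonglongrightarrow> b \<alpha>"
    if al: "\<alpha> \<in> {0..1}" for \<alpha>
  proof -
    have "Cauchy (\<lambda>n. lower (X n) \<alpha>)" "Cauchy (\<lambda>n. upper (X n) \<alpha>)"
      using C endpoint_dist_le[OF al] unfolding Cauchy_def dist_real_def
      by (meson order.strict_trans1)+
    then show "(\<lambda>n. lower (X n) \<alpha>) \<longlonglongrightarrow> a \<alpha>" "(\<lambda>n. upper (X n) \<alpha>) \<longlonglongrightarrow> b \<alpha>"
      unfolding a_def b_def by (simp_all add: Cauchy_convergent convergent_LIMSEQ_iff[symmetric])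
  qed
  have unif: "\<exists>N. \<forall>n\<ge>N. \<forall>\<alpha>\<in>{0..1}. \<bar>lower (X n) \<alpha> - a \<alpha>\<bar> \<le> e \<and> \<bar>upper (X n) \<alpha> - b \<alpha>\<bar> \<le> e"
    if e: "e > 0" for e
  proof -
    obtain N where N: "\<And>m n. m \<ge> N \<Longrightarrow> n \<ge> N \<Longrightarrow> dist (X m) (X n) < e"
      using C e unfolding Cauchy_def by blast
    have "\<bar>lower (X n) \<alpha> - a \<alpha>\<bar> \<le> e \<and> \<bar>upper (X n) \<alpha> - b \<alpha>\<bar> \<le> e"
      if n: "n \<ge> N" and al: "\<alpha> \<in> {0..1}" for n \<alpha>
    proof
      have ev: "\<bar>lower (X n) \<alpha> - lower (X m) \<alpha>\<bar> \<le> e" "\<bar>upper (X n) \<alpha> - upper (X m) \<alpha>\<bar> \<le> e"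
        if "m \<ge> N" for m
        using N[OF n that] endpoint_dist_le[OF al, of "X n" "X m"] by linarith+
      show "\<bar>lower (X n) \<alpha> - a \<alpha>\<bar> \<le> e"
        by (rule LIMSEQ_le_const2[OF tendsto_rabs[OF tendsto_diff[OF tendsto_const lim(1)[OF al]]]])
           (use ev in blast)
      show "\<bar>upper (X n) \<alpha> - b \<alpha>\<bar> \<le> e"
        by (rule LIMSEQ_le_const2[OF tendsto_rabs[OF tendsto_diff[OF tendsto_const lim(2)[OF al]]]])
           (use ev in blast)
    qed
    then show ?thesis by blast
  qed
  obtain w where w: "\<And>\<alpha>. \<alpha> \<in> {0..1} \<Longrightarrow> lower w \<alpha> = a \<alpha>" "\<And>\<alpha>. \<alpha> \<in> {0..1} \<Longrightarrow> upper w \<alpha> = b \<alpha>"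
  proof (rule fuzzy_of_uniform_limits)
    fix e :: real assume "e > 0"
    then obtain N where "\<forall>n\<ge>N. \<forall>\<alpha>\<in>{0..1}. \<bar>lower (X n) \<alpha> - a \<alpha>\<bar> \<le> e / 2 \<and> \<bar>upper (X n) \<alpha> - b \<alpha>\<bar> \<le> e / 2"
      using unif[of "e / 2"] by auto
    with \<open>e > 0\<close> show "\<exists>u. \<forall>\<alpha>\<in>{0..1}. \<bar>lower u \<alpha> - a \<alpha>\<bar> < e \<and> \<bar>upper u \<alpha> - b \<alpha>\<bar> < e"
      by (intro exI[of _ "X N"]) fastforce
  qed blast
  have "X \<longlonglongrightarrow> w"
  proof (rule metric_LIMSEQ_I)
    fix e :: real assume "e > 0"
    then obtain N where N: "\<forall>n\<ge>N. \<forall>\<alpha>\<in>{0..1}. \<bar>lower (X n) \<alpha> - a \<alpha>\<bar> \<le> e / 2 \<and> \<bar>upper (X n) \<alpha> - b \<alpha>\<bar> \<le> e / 2"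
      using unif[of "e / 2"] by auto
    have "dist (X n) w \<le> e / 2" if "n \<ge> N" for n
      using N that by (intro dist_fuzzy_leI) (simp_all add: w)
    then show "\<exists>N. \<forall>n\<ge>N. dist (X n) w < e"
      using \<open>e > 0\<close> by (intro exI[of _ N]) fastforce
  qed
  then show "convergent X" by (rule convergentI)
qed

section \<open>Series of fuzzy numbers\<close>

lemma lower_upper_scaleR:
  assumes "\<alpha> \<in> {0..1}" "k \<ge> 0"
  shows "lower (k *\<^sub>R u) \<alpha> = k * lower u \<alpha>" "upper (k *\<^sub>R u) \<alpha> = k * upper u \<alpha>"
proof -
  have "level (k *\<^sub>R u) \<alpha> = {k * lower u \<alpha>..k * upper u \<alpha>}"
    using level_eq_interval[OF assms(1), of u] assms(2)
    by (simp add: level_scaleR[OF assms(1)] image_mult_atLeastAtMost_if)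
  moreover have "k * lower u \<alpha> \<le> k * upper u \<alpha>"
    using level_eq_interval(2)[OF assms(1), of u] assms(2) by (rule mult_left_mono)
  ultimately show "lower (k *\<^sub>R u) \<alpha> = k * lower u \<alpha>" "upper (k *\<^sub>R u) \<alpha> = k * upper u \<alpha>"
    by (simp_all add: lower_def[of "k *\<^sub>R u"] upper_def[of "k *\<^sub>R u"])
qed

lemma lower_upper_sum:
  assumes "\<alpha> \<in> {0..1}"
  shows "lower (\<Sum>i\<in>A. f i) \<alpha> = (\<Sum>i\<in>A. lower (f i) \<alpha>)"
    and "upper (\<Sum>i\<in>A. f i) \<alpha> = (\<Sum>i\<in>A. upper (f i) \<alpha>)"
  by (induction A rule: infinite_finite_induct)
     (simp_all add: lower_upper_plus[OF assms] lower_upper_0[OF assms])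

text \<open>
  The distance to \<open>0\<close> plays the part of a norm. Fuzzy numbers have no differences, so a block of
  the series is estimated through the end points of two partial sums.
\<close>

lemma fuzzy_summable_comparison:
  fixes f :: "nat \<Rightarrow> fuzzy"
  assumes B: "summable B" and f: "\<And>n. dist (f n) 0 \<le> B n"
  shows "summable f"
proof -
  have end_le: "\<bar>lower (f i) \<alpha>\<bar> \<le> B i" "\<bar>upper (f i) \<alpha>\<bar> \<le> B i" if "\<alpha> \<in> {0..1}" for i \<alpha>
    using endpoint_dist_le[OF that, of "f i" 0] f[of i] by (simp_all add: lower_upper_0[OF that])
  have step: "dist (\<Sum>i<n. f i) (\<Sum>i<m. f i) \<le> (\<Sum>i=m..<n. B i)" if "m \<le> n" for m n
  proof (rule dist_fuzzy_leI)
    fix \<alpha> :: real assume al: "\<alpha> \<in> {0..1}"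
    have split: "(\<Sum>i<n. g i) - (\<Sum>i<m. g i) = (\<Sum>i=m..<n. g i)" for g :: "nat \<Rightarrow> real"
      using sum_diff_nat_ivl[of 0 m n g] that by (simp add: atLeast0LessThan)
    show "\<bar>lower (\<Sum>i<n. f i) \<alpha> - lower (\<Sum>i<m. f i) \<alpha>\<bar> \<le> (\<Sum>i=m..<n. B i)"
      and "\<bar>upper (\<Sum>i<n. f i) \<alpha> - upper (\<Sum>i<m. f i) \<alpha>\<bar> \<le> (\<Sum>i=m..<n. B i)"
      unfolding lower_upper_sum[OF al] split
      by (rule order.trans[OF sum_abs sum_mono], rule end_le[OF al])+
  qed
  have "Cauchy (\<lambda>n. \<Sum>i<n. f i)"
  proof (rule CauchyI')
    fix e :: real assume "e > 0"
    then obtain N where N: "\<And>m n. m \<ge> N \<Longrightarrow> norm (\<Sum>i=m..<n. B i) < e"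
      using B unfolding summable_Cauchy by blast
    have "dist (\<Sum>i<m. f i) (\<Sum>i<n. f i) < e" if "m \<ge> N" "m < n" for m n
      using step[of m n] N[OF that(1), of n] that by (simp add: dist_commute)
    then show "\<exists>M. \<forall>m\<ge>M. \<forall>n>m. dist (\<Sum>i<m. f i) (\<Sum>i<n. f i) < e" by blast
  qed
  then show ?thesis
    by (simp add: summable_iff_convergent Cauchy_convergent)
qed

lemma lower_upper_suminf:
  fixes f :: "nat \<Rightarrow> fuzzy"
  assumes f: "summable f" and al: "\<alpha> \<in> {0..1}"
  shows "lower (\<Sum>n. f n) \<alpha> = (\<Sum>n. lower (f n) \<alpha>)" "upper (\<Sum>n. f n) \<alpha> = (\<Sum>n. upper (f n) \<alpha>)"
proof -
  have lim: "(\<lambda>n. \<Sum>i<n. f i) \<longlonglongrightarrow> (\<Sum>n. f n)"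
    using summable_sums[OF f] by (simp add: sums_def)
  have "(\<lambda>n. lower (\<Sum>i<n. f i) \<alpha>) \<longlonglongrightarrow> lower (\<Sum>n. f n) \<alpha>"
    "(\<lambda>n. upper (\<Sum>i<n. f i) \<alpha>) \<longlonglongrightarrow> upper (\<Sum>n. f n) \<alpha>"
    by (rule metric_tendsto_imp_tendsto[OF lim], intro always_eventually allI,
        simp only: dist_real_def endpoint_dist_le[OF al])+
  then show "lower (\<Sum>n. f n) \<alpha> = (\<Sum>n. lower (f n) \<alpha>)" "upper (\<Sum>n. f n) \<alpha> = (\<Sum>n. upper (f n) \<alpha>)"
    unfolding lower_upper_sum[OF al] sums_def[symmetric] by (auto dest: sums_unique)
qed

section \<open>Euler summability implies Borel summability\<close>

lemma lower_upper_euler_mean: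
  assumes "\<alpha> \<in> {0..1}" "p > 0"
  shows "lower (euler_mean p u n) \<alpha> = real_euler_mean p (\<lambda>k. lower (u k) \<alpha>) n"
    and "upper (euler_mean p u n) \<alpha> = real_euler_mean p (\<lambda>k. upper (u k) \<alpha>) n"
  using assms
  by (simp_all add: euler_mean_def real_euler_mean_def lower_upper_scaleR lower_upper_sum)

theorem theorem4p5:
  fixes u :: "nat \<Rightarrow> fuzzy" and \<mu> :: fuzzy and p :: real
  assumes "p > 0"
    and "euler_summable_to p u \<mu>"
  shows "borel_summable_to u \<mu>"
proof -
  note p = assms(1)
  define d where "d n = dist (euler_mean p u n) \<mu>" for n
  have d0: "d \<longlonglongrightarrow> 0"
    using assms(2) unfolding d_def euler_summable_to_def by (subst (asm) tendsto_dist_iff)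
  obtain K where K: "\<And>n. d n \<le> K"
    using convergent_imp_Bseq[OF convergentI[OF d0]] by (auto simp: Bseq_def abs_le_iff)
  have mean_dist: "\<bar>real_euler_mean p (\<lambda>k. lower (u k) \<alpha>) n - lower \<mu> \<alpha>\<bar> \<le> d n"
    "\<bar>real_euler_mean p (\<lambda>k. upper (u k) \<alpha>) n - upper \<mu> \<alpha>\<bar> \<le> d n" if "\<alpha> \<in> {0..1}" for \<alpha> n
    using endpoint_dist_le[OF that, of "euler_mean p u n" \<mu>]
    by (simp_all add: d_def lower_upper_euler_mean[OF that p])
  \<comment> \<open>One bound for the Euler means of both end points at every level.\<close>
  define M where "M = K + dist \<mu> 0"
  have mean_bound: "\<bar>real_euler_mean p (\<lambda>k. lower (u k) \<alpha>) n\<bar> \<le> M"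
    "\<bar>real_euler_mean p (\<lambda>k. upper (u k) \<alpha>) n\<bar> \<le> M" if al: "\<alpha> \<in> {0..1}" for \<alpha> n
    using mean_dist[OF al, of n] K[of n] endpoint_dist_le[OF al, of \<mu> 0]
    unfolding M_def lower_upper_0[OF al] by linarith+
  have summ: "summable (\<lambda>n. (x ^ n / fact n) *\<^sub>R u n)" if x: "x > 0" for x
  proof (rule fuzzy_summable_comparison)
    show "summable (\<lambda>n. x ^ n / fact n * (M * (2 * p + 1) ^ n))"
      using summable_exp[of "x * (2 * p + 1)", THEN summable_mult, of M]
      by (simp add: power_mult_distrib divide_inverse mult_ac)
    show "dist ((x ^ n / fact n) *\<^sub>R u n) 0 \<le> x ^ n / fact n * (M * (2 * p + 1) ^ n)" for n
    proof (rule dist_fuzzy_leI)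
      fix \<alpha> :: real assume al: "\<alpha> \<in> {0..1}"
      have c: "0 \<le> x ^ n / fact n" using x by simp
      show "\<bar>lower ((x ^ n / fact n) *\<^sub>R u n) \<alpha> - lower 0 \<alpha>\<bar> \<le> x ^ n / fact n * (M * (2 * p + 1) ^ n)"
        and "\<bar>upper ((x ^ n / fact n) *\<^sub>R u n) \<alpha> - upper 0 \<alpha>\<bar> \<le> x ^ n / fact n * (M * (2 * p + 1) ^ n)"
        unfolding lower_upper_scaleR[OF al c] lower_upper_0[OF al] diff_0_right abs_mult abs_of_nonneg[OF c]
        using euler_mean_bound_terms[OF p mean_bound(1)[OF al], of n]
          euler_mean_bound_terms[OF p mean_bound(2)[OF al], of n]
        by - (intro mult_left_mono c; assumption)+
    qed
  qed
  define E where "E y = exp (- y) * (\<Sum>n. y ^ n / fact n * d n)" for y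
  have err: "dist (exp (- x) *\<^sub>R (\<Sum>n. (x ^ n / fact n) *\<^sub>R u n)) \<mu> \<le> E ((p + 1) * x)" if x: "x > 0" for x
  proof (rule dist_fuzzy_leI)
    fix \<alpha> :: real assume al: "\<alpha> \<in> {0..1}"
    have c: "0 \<le> x ^ n / fact n" for n using x by simp
    have y: "\<bar>(p + 1) * x\<bar> = (p + 1) * x" using p x by simp
    show "\<bar>lower (exp (- x) *\<^sub>R (\<Sum>n. (x ^ n / fact n) *\<^sub>R u n)) \<alpha> - lower \<mu> \<alpha>\<bar> \<le> E ((p + 1) * x)"
      using borel_mean_error_bound[OF p mean_dist(1)[OF al] K, of x]
      unfolding lower_upper_scaleR[OF al exp_ge_zero] lower_upper_suminf[OF summ[OF x] al]
        lower_upper_scaleR[OF al c] E_def y .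
    show "\<bar>upper (exp (- x) *\<^sub>R (\<Sum>n. (x ^ n / fact n) *\<^sub>R u n)) \<alpha> - upper \<mu> \<alpha>\<bar> \<le> E ((p + 1) * x)"
      using borel_mean_error_bound[OF p mean_dist(2)[OF al] K, of x]
      unfolding lower_upper_scaleR[OF al exp_ge_zero] lower_upper_suminf[OF summ[OF x] al]
        lower_upper_scaleR[OF al c] E_def y .
  qed
  have "filterlim (\<lambda>x. (p + 1) * x) at_top at_top"
    using p by (intro filterlim_tendsto_pos_mult_at_top[OF tendsto_const _ filterlim_ident]) simp
  then have "((\<lambda>x. E ((p + 1) * x)) \<longlongrightarrow> 0) at_top"
    unfolding E_def by (rule filterlim_compose[OF borel_regular_null[OF d0]])
  moreover have "\<forall>\<^sub>F x in at_top. norm (dist (exp (- x) *\<^sub>R (\<Sum>n. (x ^ n / fact n) *\<^sub>R u n)) \<mu>) \<le> E ((p + 1) * x)"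
    using eventually_gt_at_top[of 0] by eventually_elim (use err in simp)
  ultimately have "((\<lambda>x. dist (exp (- x) *\<^sub>R (\<Sum>n. (x ^ n / fact n) *\<^sub>R u n)) \<mu>) \<longlongrightarrow> 0) at_top"
    by (rule Lim_null_comparison[rotated])
  then have "((\<lambda>x. exp (- x) *\<^sub>R (\<Sum>n. (x ^ n / fact n) *\<^sub>R u n)) \<longlongrightarrow> \<mu>) at_top"
    by (subst tendsto_dist_iff)
  then show ?thesis
    using summ unfolding borel_summable_to_def by blast
qed

end
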